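(* There is an absolute constant $c>0$ such that for arbitrarily large $n$ there is an access sequence $\tilde X\in[n]^m$ (for some $m$) satisfying $\mathsf{Funnel}(\tilde X)\ge c\,\lg\lg n\cdot(\mathsf{Alt}_\mathcal{T}(\tilde X)+m)$ simultaneously for all reference trees $\mathcal{T}$ for $G_{\tilde X}$.
   Context: Geometric view: for $X=(x_1,\dots,x_m)$ let $G_X=\{(x_i,i): i\in[m]\}\subset\mathbb{R}^2$. For a point $p$ write $p.x,p.y$ for its coordinates, and for a set $P$ write $P.x=\{p.x:p\in P\}$, $P.y=\{p.y:p\in P\}$. Mixing value: for disjoint finite sets $L,R\subset\mathbb{R}$, $\mathrm{mix}(L,R)\in\{\mathtt{L},\mathtt{R}\}^*$ is the word obtained by listing $L\cup R$ in increasing order and writing $\mathtt{L}$ for elements of $L$ and $\mathtt{R}$ for elements of $R$; $\mathrm{blocks}(s)$ is $0$ for the empty word and otherwise the number of maximal runs of equal letters; $\mathrm{mixValue}(L,R)=\mathrm{blocks}(\mathrm{mix}(L,R))$. Alternation bound: let $P$ be a finite point set with distinct $y$-coordinates. A reference tree for $P$ is a binary tree in which every non-leaf node has exactly two children and whose leaves are labeled by the elements of $P.x$ in increasing left-to-right order. If $\mathcal{T}$ is a single node, $\mathsf{Alt}_\mathcal{T}(P)=0$. Otherwise, with left/right subtrees $\mathcal{T}_L,\mathcal{T}_R$ of the root, let $P_L=\{p\in P: p.x \text{ labels a leaf of } \mathcal{T}_L\}$, $P_R$ analogously, and $\mathsf{Alt}_\mathcal{T}(P)=\mathrm{mixValue}(P_L.y,P_R.y)+\mathsf{Alt}_{\mathcal{T}_L}(P_L)+\mathsf{Alt}_{\mathcal{T}_R}(P_R)$.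 Set $\mathsf{Alt}_\mathcal{T}(X)=\mathsf{Alt}_\mathcal{T}(G_X)$. Funnel bound: $\mathrm{rect}(p,q)$ is the smallest closed axis-aligned rectangle containing $p$ and $q$. For $p\in P$, the left funnel $F_L(P,p)$ is the set of $q\in P$ with $q.y<p.y$, $q.x<p.x$ and $P\cap\mathrm{rect}(p,q)=\{p,q\}$; the right funnel $F_R(P,p)$ is defined the same way with $q.x>p.x$. Let $f(P,p)=\mathrm{mixValue}(F_L(P,p).y,F_R(P,p).y)$ and $\mathsf{Funnel}(P)=\sum_{p\in P}f(P,p)$; $\mathsf{Funnel}(X)=\mathsf{Funnel}(G_X)$. $\lg$ denotes $\log_2$. *)

theory Defs
  imports Complex_Main
begin

type_synonym point = "real \<times> real"

text \<open>Positions in an access sequence are numbered from 1, whereas list indices start at 0.\<close>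

definition access_points :: "nat list \<Rightarrow> point set" where
  "access_points X = {(real (X ! (i - 1)), real i) | i. i \<in> {1..length X}}"

datatype side = Lft | Rgt

definition mix :: "real set \<Rightarrow> real set \<Rightarrow> side list" where
  "mix L R = map (\<lambda>v. if v \<in> L then Lft else Rgt) (sorted_list_of_set (L \<union> R))"

text \<open>\<^const>\<open>remdups_adj\<close> collapses every maximal run of equal letters to a single letter.\<close>

definition blocks :: "side list \<Rightarrow> nat" where
  "blocks s = length (remdups_adj s)"

definition mix_value :: "real set \<Rightarrow> real set \<Rightarrow> nat" where
  "mix_value L R = blocks (mix L R)"

datatype ref_tree = Leaf real | Node ref_tree ref_tree

fun leaf_labels :: "ref_tree \<Rightarrow> real list" where
  "leaf_labels (Leaf x) = [x]"
| "leaf_labels (Node l r) = leaf_labels l @ leaf_labels r"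

definition is_reference_tree :: "ref_tree \<Rightarrow> point set \<Rightarrow> bool" where
  "is_reference_tree T P \<longleftrightarrow> sorted_wrt (<) (leaf_labels T) \<and> set (leaf_labels T) = fst ` P"

fun Alt :: "ref_tree \<Rightarrow> point set \<Rightarrow> nat" where
  "Alt (Leaf x) P = 0"
| "Alt (Node l r) P =
    (let PL = {p \<in> P. fst p \<in> set (leaf_labels l)};
         PR = {p \<in> P. fst p \<in> set (leaf_labels r)}
     in mix_value (snd ` PL) (snd ` PR) + Alt l PL + Alt r PR)"

definition rect :: "point \<Rightarrow> point \<Rightarrow> point set" where
  "rect p q = {min (fst p) (fst q)..max (fst p) (fst q)} \<times>
              {min (snd p) (snd q)..max (snd p) (snd q)}"

definition left_funnel :: "point set \<Rightarrow> point \<Rightarrow> point set" where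
  "left_funnel P p = {q \<in> P. snd q < snd p \<and> fst q < fst p \<and> P \<inter> rect p q = {p, q}}"

definition right_funnel :: "point set \<Rightarrow> point \<Rightarrow> point set" where
  "right_funnel P p = {q \<in> P. snd q < snd p \<and> fst q > fst p \<and> P \<inter> rect p q = {p, q}}"

definition funnel_value :: "point set \<Rightarrow> point \<Rightarrow> nat" where
  "funnel_value P p = mix_value (snd ` left_funnel P p) (snd ` right_funnel P p)"

definition Funnel :: "point set \<Rightarrow> nat" where
  "Funnel P = (\<Sum>p\<in>P. funnel_value P p)"

end

theory Submission imports Defs "HOL-Library.Sublist" begin

text \<open>
  Put \<open>K = 2 ^ k\<close> and \<open>S = 2 ^ (K - 1)\<close>. For every shift \<open>s < S\<close> the sequence accesses the \<open>K\<close>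
  keys \<open>s + 2 ^ i\<close> in bit-reversal order of \<open>i\<close>, and repeats this \<open>S\<close> times before moving on to
  the next shift; all keys are below \<open>2 ^ K\<close>.

  Funnel: when \<open>t\<close> is the time within a repetition, the access at time \<open>t - 2 ^ j\<close> lies in the
  funnel of the access at time \<open>t\<close>, on the side given by the \<open>j\<close>-th bit of \<open>t\<close>. So the funnel
  alternates at least as often as the bits of \<open>t\<close>, which is of order \<open>k = lg K\<close> on average.

  Alternation: consider a node of a reference tree that splits the keys \<open>[a, b)\<close> into \<open>[a, t)\<close> and
  \<open>[t, b)\<close>, and let \<open>L\<close> and \<open>R\<close> count the keys of shift \<open>s\<close> in the two parts. The node
  contributes at most \<open>2 * min L R\<close> per repetition, up to an additive constant per shift that
  the repetitions amortise. Summed over \<open>s\<close>, \<open>min L R\<close> is at most three times the number of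
  pairs \<open>(x, x + 2 ^ i)\<close> that the node separates. Since every such pair is separated by at most
  one node, all nodes together contribute only a constant per access, whatever the tree.
\<close>

subsection \<open>Blocks of words\<close>

lemma length_remdups_adj_Cons:
  "length (remdups_adj (x # xs)) = length (remdups_adj xs) + (if xs \<noteq> [] \<and> hd xs = x then 0 else 1)"
  by (cases xs) auto

text \<open>The extra unit is what the induction needs: if the heads differ, no letter of
  \<open>xs\<close> can be matched within the first block of \<open>ys\<close>, so that block is to
  spare.\<close>

lemma length_remdups_adj_subseq_hd:
  assumes "subseq xs ys"
  shows "length (remdups_adj xs) + (if xs \<noteq> [] \<and> hd xs \<noteq> hd ys then 1 else 0)
    \<le> length (remdups_adj ys)"
  using assms
proof (induction rule: list_emb.induct)
  case (list_emb_Cons xs ys y)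
  moreover have "xs = []" if "ys = []" using list_emb_Cons that by simp
  ultimately show ?case
    by (cases "ys = []") (auto simp: length_remdups_adj_Cons split: if_splits)
next
  case (list_emb_Cons2 x y xs ys)
  then show ?case
    by (cases "ys = []") (auto simp: length_remdups_adj_Cons split: if_splits)
qed simp

lemma length_remdups_adj_subseq:
  "subseq xs ys \<Longrightarrow> length (remdups_adj xs) \<le> length (remdups_adj ys)"
  using length_remdups_adj_subseq_hd by fastforce

lemma length_remdups_adj_append:
  "length (remdups_adj (xs @ ys)) \<le> length (remdups_adj xs) + length (remdups_adj ys)"
  by (induction xs) (auto simp: length_remdups_adj_Cons hd_append split: if_splits)

text \<open>With two letters, every block of the other letter follows a block of \<open>c\<close>,
  except possibly the first block. If the word starts with \<open>c\<close>, that exception is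
  absent, which the induction records in the extra unit.\<close>

lemma blocks_le_count_hd:
  "blocks w + (if w \<noteq> [] \<and> hd w = c then 1 else 0) \<le> 2 * count_list w c + 1"
proof (induction w)
  case (Cons x w)
  show ?case
    using Cons by (cases x; cases c; cases "w = []"; cases "hd w")
      (auto simp: blocks_def length_remdups_adj_Cons)
qed (simp add: blocks_def)

lemma blocks_le_count: "blocks w \<le> 2 * count_list w c + 1"
  using blocks_le_count_hd[of w c] by linarith

lemma count_list_map_distinct:
  "distinct xs \<Longrightarrow> count_list (map f xs) c = card {x \<in> set xs. f x = c}"
proof (induction xs)
  case (Cons x xs)
  have "{y \<in> set (x # xs). f y = c}
    = (if f x = c then insert x {y \<in> set xs. f y = c} else {y \<in> set xs. f y = c})" by auto
  then show ?case using Cons by auto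
qed simp

section \<open>Upper bounds on the mixing value\<close>

lemma mix_value_le_min:
  assumes "finite L" "finite R" "L \<inter> R = {}"
  shows "mix_value L R \<le> 2 * min (card L) (card R) + 1"
proof -
  have "count_list (mix L R) Lft = card L"
    using assms unfolding mix_def
    by (subst count_list_map_distinct) (auto intro!: arg_cong[where f = card])
  moreover have "count_list (mix L R) Rgt = card R"
    using assms unfolding mix_def
    by (subst count_list_map_distinct) (auto intro!: arg_cong[where f = card])
  ultimately show ?thesis
    using blocks_le_count[of "mix L R" Lft] blocks_le_count[of "mix L R" Rgt]
    by (simp add: mix_value_def min_def)
qed

lemma sorted_list_of_set_split:
  fixes A :: "'a::linorder set"
  assumes "finite A"
  shows "sorted_list_of_set A = sorted_list_of_set (A \<inter> {..<c}) @ sorted_list_of_set (A \<inter> {c..})"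
proof (rule sorted_distinct_set_unique)
  show "set (sorted_list_of_set A)
    = set (sorted_list_of_set (A \<inter> {..<c}) @ sorted_list_of_set (A \<inter> {c..}))"
    using assms by auto
qed (use assms in \<open>auto simp: sorted_append\<close>)

lemma mix_value_split:
  assumes "finite L" "finite R"
  shows "mix_value L R \<le> mix_value (L \<inter> {..<c}) (R \<inter> {..<c}) + mix_value (L \<inter> {c..}) (R \<inter> {c..})"
proof -
  have "mix L R = mix (L \<inter> {..<c}) (R \<inter> {..<c}) @ mix (L \<inter> {c..}) (R \<inter> {c..})"
    using assms unfolding mix_def
    by (subst sorted_list_of_set_split[of _ c]) (auto simp: Int_Un_distrib2)
  then show ?thesis
    by (simp add: mix_value_def blocks_def length_remdups_adj_append)
qed

text \<open>Time is cut into \<open>n\<close> windows of length \<open>W\<close>, each bounded on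
  its own by its rarer letter. The price is an additive 1 per window.\<close>

lemma mix_value_windows:
  fixes W n :: nat
  assumes "A \<inter> B = {}" "A \<subseteq> {..<n * W}" "B \<subseteq> {..<n * W}"
  shows "mix_value ((\<lambda>i. real (Suc i)) ` A) ((\<lambda>i. real (Suc i)) ` B)
    \<le> (\<Sum>s<n. 2 * min (card {i \<in> A. i div W = s}) (card {i \<in> B. i div W = s}) + 1)"
  using assms
proof (induction n arbitrary: A B)
  case 0
  then show ?case by (simp add: mix_value_def mix_def blocks_def)
next
  case (Suc n)
  let ?e = "\<lambda>i. real (Suc i)"
  define c where "c = ?e (n * W)"
  have fin: "finite A" "finite B" using Suc.prems(2,3) by (auto intro: finite_subset)
  \<comment> \<open>For \<open>W = 0\<close> both sets are empty; otherwise division by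
    \<open>W\<close> behaves as expected.\<close>
  have W: "W > 0 \<or> A = {} \<and> B = {}" using Suc.prems by (cases W) auto
  have lo: "?e ` C \<inter> {..<c} = ?e ` {i \<in> C. i < n * W}" for C by (auto simp: c_def simp flip: of_nat_mult)
  have hi: "?e ` C \<inter> {c..} = ?e ` {i \<in> C. n * W \<le> i}" for C by (auto simp: c_def simp flip: of_nat_mult)
  have cl: "{i \<in> {i \<in> C. i < n * W}. i div W = s} = {i \<in> C. i div W = s}"
    if "s < n" "W > 0 \<or> C = {}" for s C
    using that by (auto simp: div_less_iff_less_mult)
  have ch: "{i \<in> C. n * W \<le> i} = {i \<in> C. i div W = n}"
    if "C \<subseteq> {..<Suc n * W}" "W > 0 \<or> C = {}" for C
    using that by (auto intro!: div_nat_eqI simp: mult.commute)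
  have "mix_value (?e ` {i \<in> A. i < n * W}) (?e ` {i \<in> B. i < n * W})
    \<le> (\<Sum>s<n. 2 * min (card {i \<in> {i \<in> A. i < n * W}. i div W = s})
                     (card {i \<in> {i \<in> B. i < n * W}. i div W = s}) + 1)"
    using Suc.prems by (intro Suc.IH) auto
  also have "\<dots> = (\<Sum>s<n. 2 * min (card {i \<in> A. i div W = s}) (card {i \<in> B. i div W = s}) + 1)"
  proof (intro sum.cong refl)
    fix s assume "s \<in> {..<n}"
    then have "s < n" by simp
    have "{i \<in> {i \<in> A. i < n * W}. i div W = s} = {i \<in> A. i div W = s}"
      "{i \<in> {i \<in> B. i < n * W}. i div W = s} = {i \<in> B. i div W = s}"
      using W by (intro cl \<open>s < n\<close>; blast)+
    then show "2 * min (card {i \<in> {i \<in> A. i < n * W}. i div W = s})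
                     (card {i \<in> {i \<in> B. i < n * W}. i div W = s}) + 1
      = 2 * min (card {i \<in> A. i div W = s}) (card {i \<in> B. i div W = s}) + 1"
      by (simp only:)
  qed
  finally have 1: "mix_value (?e ` {i \<in> A. i < n * W}) (?e ` {i \<in> B. i < n * W}) \<le> \<dots>" .
  have inj: "inj_on ?e C" for C by (auto simp: inj_on_def)
  have "mix_value (?e ` {i \<in> A. i div W = n}) (?e ` {i \<in> B. i div W = n})
    \<le> 2 * min (card {i \<in> A. i div W = n}) (card {i \<in> B. i div W = n}) + 1"
  proof -
    have "?e ` {i \<in> A. i div W = n} \<inter> ?e ` {i \<in> B. i div W = n} = {}"
      using Suc.prems(1) unfolding disjoint_iff by auto
    from mix_value_le_min[OF _ _ this] show ?thesis using fin unfolding card_image[OF inj] by simp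
  qed
  moreover have "{i \<in> A. n * W \<le> i} = {i \<in> A. i div W = n}"
    "{i \<in> B. n * W \<le> i} = {i \<in> B. i div W = n}"
    using W by (intro ch Suc.prems; blast)+
  then have "mix_value (?e ` A) (?e ` B)
    \<le> mix_value (?e ` {i \<in> A. i < n * W}) (?e ` {i \<in> B. i < n * W})
      + mix_value (?e ` {i \<in> A. i div W = n}) (?e ` {i \<in> B. i div W = n})"
    using mix_value_split[of "?e ` A" "?e ` B" c] fin by (simp only: lo hi finite_imageI)
  ultimately show ?case using 1 unfolding sum.lessThan_Suc by linarith
qed

section \<open>Lower bounds on the mixing value\<close>

text \<open>Restricting both sets to \<open>B\<close> deletes letters from the word, and deletion
  never creates blocks.\<close>

lemma mix_value_mono:
  assumes "finite L" "finite R"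
  shows "mix_value (L \<inter> B) (R \<inter> B) \<le> mix_value L R"
proof -
  have "sorted_list_of_set ((L \<union> R) \<inter> B) = filter (\<lambda>v. v \<in> B) (sorted_list_of_set (L \<union> R))"
    using assms by (intro sorted_distinct_set_unique) (auto intro: sorted_filter[of id, simplified])
  then have "mix (L \<inter> B) (R \<inter> B)
    = map (\<lambda>v. if v \<in> L then Lft else Rgt) (filter (\<lambda>v. v \<in> B) (sorted_list_of_set (L \<union> R)))"
    unfolding mix_def Int_Un_distrib2[symmetric] by (auto intro!: map_cong)
  then have "subseq (mix (L \<inter> B) (R \<inter> B)) (mix L R)"
    unfolding mix_def by (auto intro: subseq_map)
  then show ?thesis
    by (simp add: mix_value_def blocks_def length_remdups_adj_subseq)
qed

lemma length_remdups_adj_map_rev: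
  "length (remdups_adj (map f (rev [0..<Suc n]))) = card {j. j < n \<and> f j \<noteq> f (Suc j)} + 1"
proof (induction n)
  case (Suc n)
  have "{j. j < Suc n \<and> f j \<noteq> f (Suc j)}
    = (if f n \<noteq> f (Suc n) then insert n {j. j < n \<and> f j \<noteq> f (Suc j)} else {j. j < n \<and> f j \<noteq> f (Suc j)})"
    by (auto simp: less_Suc_eq)
  then show ?case using Suc by (auto simp: length_remdups_adj_Cons)
qed simp

text \<open>Some known elements \<open>y 0, ..., y n\<close> suffice for a lower bound. They
  decrease in \<open>j\<close>, so the word restricted to them reads the indices backwards.\<close>

lemma mix_value_ge_alternations:
  fixes y :: "nat \<Rightarrow> real"
  assumes "finite L" "finite R" and dec: "\<And>i j. i < j \<Longrightarrow> j \<le> n \<Longrightarrow> y j < y i"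
    and "\<And>j. j \<le> n \<Longrightarrow> y j \<in> L \<union> R"
  shows "card {j. j < n \<and> (y j \<in> L) \<noteq> (y (Suc j) \<in> L)} + 1 \<le> mix_value L R"
proof -
  define B where "B = y ` {..n}"
  have "sorted_list_of_set ((L \<inter> B) \<union> (R \<inter> B)) = map y (rev [0..<Suc n])"
  proof (rule sorted_distinct_set_unique)
    have "sorted_wrt (\<lambda>a b. b < a) (map y [0..<Suc n])"
      using dec by (auto simp: sorted_wrt_iff_nth_less simp del: upt_Suc)
    then have "sorted_wrt (<) (rev (map y [0..<Suc n]))"
      by (simp add: sorted_wrt_rev del: upt_Suc)
    then have "sorted_wrt (<) (map y (rev [0..<Suc n]))" by (simp only: rev_map)
    then show "sorted (map y (rev [0..<Suc n]))" "distinct (map y (rev [0..<Suc n]))"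
      using strict_sorted_iff by blast+
    have "(L \<inter> B) \<union> (R \<inter> B) = B" using assms(4) by (auto simp: B_def)
    then show "set (sorted_list_of_set ((L \<inter> B) \<union> (R \<inter> B))) = set (map y (rev [0..<Suc n]))"
      by (simp add: B_def atLeast0LessThan lessThan_Suc_atMost del: upt_Suc)
  qed auto
  moreover have "map (\<lambda>v. if v \<in> L \<inter> B then Lft else Rgt) (map y (rev [0..<Suc n]))
      = map (\<lambda>j. if y j \<in> L then Lft else Rgt) (rev [0..<Suc n])"
    by (auto simp: B_def simp del: upt_Suc)
  ultimately have "mix_value (L \<inter> B) (R \<inter> B)
    = length (remdups_adj (map (\<lambda>j. if y j \<in> L then Lft else Rgt) (rev [0..<Suc n])))"
    unfolding mix_value_def blocks_def mix_def by argo
  also have "\<dots> = card {j. j < n \<and> (y j \<in> L) \<noteq> (y (Suc j) \<in> L)} + 1"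
    by (subst length_remdups_adj_map_rev) (auto intro!: arg_cong[where f = card])
  finally show ?thesis using mix_value_mono[OF assms(1,2), of B] by simp
qed

subsection \<open>Bit reversal\<close>

text \<open>The lowest bit of \<open>t\<close> becomes the top bit, so comparing two values compares
  parities first and then recurses on \<open>t div 2\<close>.\<close>

fun bitrev :: "nat \<Rightarrow> nat \<Rightarrow> nat" where
  "bitrev 0 t = 0"
| "bitrev (Suc k) t = bitrev k (t div 2) + (if odd t then 2 ^ k else 0)"

lemma bitrev_less: "bitrev k t < 2 ^ k"
proof (induction k arbitrary: t)
  case (Suc k)
  show ?case using Suc[of "t div 2"] by auto
qed simp

lemma inj_on_bitrev: "inj_on (bitrev k) {..<2 ^ k}"
proof (induction k)
  case (Suc k)
  show ?case
  proof (rule inj_onI)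
    fix t u assume *: "t \<in> {..<2 ^ Suc k}" "u \<in> {..<2 ^ Suc k}" "bitrev (Suc k) t = bitrev (Suc k) u"
    have "odd t = odd u" "bitrev k (t div 2) = bitrev k (u div 2)"
      using *(3) bitrev_less[of k "t div 2"] bitrev_less[of k "u div 2"] by (auto split: if_splits)
    moreover have "t div 2 \<in> {..<2 ^ k}" "u div 2 \<in> {..<2 ^ k}" using *(1,2) by auto
    ultimately have "t div 2 = u div 2" using inj_onD[OF Suc] by blast
    with \<open>odd t = odd u\<close> show "t = u" by presburger
  qed
qed (simp add: inj_on_def)

lemma sub_power_Suc_div_2:
  fixes t :: nat
  shows "(t - 2 ^ Suc j) div 2 = t div 2 - 2 ^ j"
  by (simp add: div_diff)

text \<open>Subtracting \<open>2 ^ j\<close> keeps the bits below position \<open>j\<close> and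
  flips bit \<open>j\<close>. After reversal the kept bits are the more significant ones, so bit
  \<open>j\<close> decides the comparison.\<close>

lemma bitrev_sub_power:
  assumes "j < k" "2 ^ j \<le> t"
  shows "if odd (t div 2 ^ j) then bitrev k (t - 2 ^ j) < bitrev k t
         else bitrev k t < bitrev k (t - 2 ^ j)"
  using assms
proof (induction k arbitrary: j t)
  case (Suc k)
  show ?case
  proof (cases j)
    case 0
    then show ?thesis
      using Suc.prems bitrev_less[of k "t div 2"] bitrev_less[of k "(t - 1) div 2"]
      by (auto simp: odd_pos elim: oddE)
  next
    case (Suc j')
    have *: "2 ^ j' \<le> t div 2" "j' < k" using Suc.prems \<open>j = Suc j'\<close> by auto
    have "odd (t - 2 ^ j) = odd t" using Suc.prems \<open>j = Suc j'\<close> by auto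
    moreover have "t div 2 ^ j = t div 2 div 2 ^ j'" using \<open>j = Suc j'\<close> by (simp add: div_mult2_eq)
    moreover have "(t - 2 ^ j) div 2 = t div 2 - 2 ^ j'"
      using \<open>j = Suc j'\<close> sub_power_Suc_div_2 by blast
    ultimately show ?thesis
      using Suc.IH[OF *(2,1)] by auto
  qed
qed simp

text \<open>The numbers \<open>t\<close> and \<open>t - 2 ^ j\<close> agree in their lowest
  \<open>j\<close> bits, while \<open>u\<close> differs from \<open>t\<close> in one of these. The
  lowest such bit puts the reversal of \<open>u\<close> on the same side of both.\<close>

lemma bitrev_not_between:
  assumes "j < k" "2 ^ j \<le> t" "t - 2 ^ j < u" "u < t"
  shows "bitrev k u < min (bitrev k t) (bitrev k (t - 2 ^ j)) \<or>
         max (bitrev k t) (bitrev k (t - 2 ^ j)) < bitrev k u"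
  using assms
proof (induction k arbitrary: j t u)
  case (Suc k)
  show ?case
  proof (cases j)
    case 0
    then show ?thesis using Suc.prems by auto
  next
    case (Suc j')
    have *: "2 ^ j' \<le> t div 2" "j' < k" using Suc.prems \<open>j = Suc j'\<close> by auto
    have par: "odd (t - 2 ^ j) = odd t" using Suc.prems \<open>j = Suc j'\<close> by auto
    show ?thesis
    proof (cases "odd u = odd t")
      case True
      have "u div 2 < t div 2" using True Suc.prems(4) by presburger
      moreover have "(t - 2 ^ j) div 2 < u div 2" using True par Suc.prems(3) by presburger
      ultimately show ?thesis
        using Suc.IH[OF *(2,1), of "u div 2"] True par \<open>j = Suc j'\<close>
        by (auto simp: sub_power_Suc_div_2 simp del: power_Suc)
    next
      case False
      then show ?thesis
        using par bitrev_less[of k "t div 2"] bitrev_less[of k "u div 2"]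
          bitrev_less[of k "(t - 2 ^ j) div 2"] by auto
    qed
  qed
qed simp

section \<open>Changes between adjacent bits and their average\<close>

definition bit_changes :: "nat \<Rightarrow> nat \<Rightarrow> nat" where
  "bit_changes k r = card {j. j < k \<and> odd (r div 2 ^ j) \<noteq> odd (r div 2 ^ Suc j)}"

text \<open>Appending the bit \<open>e\<close> shifts the old bits up and creates one new adjacent
  pair, \<open>e\<close> and the lowest bit of \<open>r\<close>.\<close>

lemma bit_changes_double:
  assumes "e < 2"
  shows "bit_changes (Suc k) (2 * r + e) = bit_changes k r + (if odd e \<noteq> odd r then 1 else 0)"
proof -
  let ?A = "{j. j < k \<and> odd (r div 2 ^ j) \<noteq> odd (r div 2 ^ Suc j)}"
  have d: "(2 * r + e) div 2 ^ Suc j = r div 2 ^ j" for j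
    using assms by (simp add: div_mult2_eq)
  have "{j. j < Suc k \<and> odd ((2 * r + e) div 2 ^ j) \<noteq> odd ((2 * r + e) div 2 ^ Suc j)}
     = Suc ` ?A \<union> (if odd e \<noteq> odd r then {0} else {})" (is "?B = _")
  proof (rule set_eqI)
    fix j show "j \<in> ?B \<longleftrightarrow> j \<in> Suc ` ?A \<union> (if odd e \<noteq> odd r then {0} else {})"
      using d[of 0] by (cases j) (auto simp: d image_iff simp del: power_Suc)
  qed
  then show ?thesis
    by (auto simp: bit_changes_def card_image)
qed

text \<open>Among numbers with exactly \<open>k + 1\<close> binary digits, half of the adjacent
  pairs change on average: of the two extensions \<open>2 * r\<close> and \<open>2 * r + 1\<close>,
  exactly one gains a change.\<close>

lemma sum_bit_changes: "2 * (\<Sum>r = 2 ^ k..<2 ^ Suc k. bit_changes k r) = k * 2 ^ k"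
proof (induction k)
  case 0
  show ?case by (simp add: bit_changes_def)
next
  case (Suc k)
  have "(\<Sum>r = 2 ^ Suc k..<2 ^ Suc (Suc k). bit_changes (Suc k) r)
    = (\<Sum>r\<in>{2 ^ k..<2 ^ Suc k}. \<Sum>e<2. bit_changes (Suc k) (2 * r + e))"
    unfolding sum.cartesian_product
    by (rule sum.reindex_bij_witness[of _ "\<lambda>(r, e). 2 * r + e" "\<lambda>r. (r div 2, r mod 2)"]) auto
  also have "\<dots> = (\<Sum>r = 2 ^ k..<2 ^ Suc k. 2 * bit_changes k r + 1)"
    using bit_changes_double[of 0 k] bit_changes_double[of 1 k]
    by (intro sum.cong refl) (auto simp: numeral_2_eq_2)
  also have "\<dots> = 2 * (\<Sum>r = 2 ^ k..<2 ^ Suc k. bit_changes k r) + 2 ^ k"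
    by (subst sum.distrib) (simp add: sum_distrib_left)
  finally show ?case using Suc by simp
qed

subsection \<open>Separated pairs\<close>

text \<open>A pair \<open>(x, i)\<close> encodes the edge from \<open>x\<close> to
  \<open>x + 2 ^ i\<close>. The number of edges inside the key interval of a node serves as a
  potential for the alternation bound.\<close>

definition inner_pairs :: "nat \<Rightarrow> nat \<Rightarrow> nat \<Rightarrow> (nat \<times> nat) set" where
  "inner_pairs K a b = {(x, i). i < K \<and> a \<le> x \<and> x + 2 ^ i < b}"

definition crossing_pairs :: "nat \<Rightarrow> nat \<Rightarrow> nat \<Rightarrow> nat \<Rightarrow> (nat \<times> nat) set" where
  "crossing_pairs K a t b = {(x, i). i < K \<and> a \<le> x \<and> x < t \<and> t \<le> x + 2 ^ i \<and> x + 2 ^ i < b}"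

lemma inner_pairs_subset: "inner_pairs K a b \<subseteq> {a..<b} \<times> {..<K}"
  by (auto simp: inner_pairs_def)

lemma finite_inner_pairs: "finite (inner_pairs K a b)"
  by (rule finite_subset[OF inner_pairs_subset]) simp

lemma card_inner_pairs_le: "card (inner_pairs K a b) \<le> (b - a) * K"
  using card_mono[OF _ inner_pairs_subset[of K a b]] by simp

lemma crossing_pairs_subset: "crossing_pairs K a t b \<subseteq> inner_pairs K a b"
  by (auto simp: crossing_pairs_def inner_pairs_def)

lemma finite_crossing_pairs: "finite (crossing_pairs K a t b)"
  by (rule finite_subset[OF crossing_pairs_subset finite_inner_pairs])

text \<open>The edges on the left of \<open>t\<close>, on the right of \<open>t\<close> and across
  \<open>t\<close> are disjoint classes, so an edge is charged by at most one node of the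
  tree.\<close>

lemma card_inner_pairs_split:
  assumes "a \<le> t" "t \<le> b"
  shows "card (inner_pairs K a t) + card (inner_pairs K t b) + card (crossing_pairs K a t b)
    \<le> card (inner_pairs K a b)"
proof -
  have "inner_pairs K a t \<inter> inner_pairs K t b = {}"
    "(inner_pairs K a t \<union> inner_pairs K t b) \<inter> crossing_pairs K a t b = {}"
    by (auto simp: inner_pairs_def crossing_pairs_def)
  then have "card (inner_pairs K a t) + card (inner_pairs K t b) + card (crossing_pairs K a t b)
    = card (inner_pairs K a t \<union> inner_pairs K t b \<union> crossing_pairs K a t b)"
    by (simp add: card_Un_disjoint finite_inner_pairs finite_crossing_pairs)
  also have "\<dots> \<le> card (inner_pairs K a b)"
    using assms by (intro card_mono finite_inner_pairs) (auto simp: inner_pairs_def crossing_pairs_def)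
  finally show ?thesis .
qed

text \<open>
  For \<open>s\<close> to the left of the interval, the largest key in \<open>[a, t)\<close> and the smallest in \<open>[t, b)\<close> form
  one separated pair. Every further key \<open>s + 2 ^ i\<close> in \<open>[a, t)\<close> satisfies \<open>2 ^ i < t - a\<close>, and
  \<open>2 ^ i < b - t\<close> as soon as there are two keys in \<open>[t, b)\<close>, so that translating the pair
  \<open>(s, s + 2 ^ i)\<close>, which straddles \<open>a\<close>, by \<open>t - a\<close> gives another separated pair.
\<close>

lemma min_card_powers_le:
  fixes s a t b K :: nat
  assumes "a \<le> t" "t \<le> b"
  defines "L \<equiv> {i. i < K \<and> a \<le> s + 2 ^ i \<and> s + 2 ^ i < t}"
    and "R \<equiv> {i. i < K \<and> t \<le> s + 2 ^ i \<and> s + 2 ^ i < b}"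
  shows "min (card L) (card R)
    \<le> card {i. (s, i) \<in> crossing_pairs K a t b}
      + card {i. (s + 2 ^ i, i) \<in> crossing_pairs K a t b}
      + card {i. (s + (t - a), i) \<in> crossing_pairs K a t b}"
    (is "_ \<le> card ?A + card ?B + card ?C")
proof -
  have sub: "?A \<subseteq> {..<K}" "?B \<subseteq> {..<K}" "?C \<subseteq> {..<K}" by (auto simp: crossing_pairs_def)
  then have fin: "finite ?A" "finite ?B" "finite ?C" using finite_subset by blast+
  have finLR: "finite L" "finite R" by (auto simp: L_def R_def)
  consider "L = {} \<or> R = {}" | "a \<le> s" "L \<noteq> {}" | "s < a" "L \<noteq> {}" "R \<noteq> {}" by force
  then show ?thesis
  proof cases
    case 1
    then show ?thesis by auto
  next
    case 2
    \<comment> \<open>Since \<open>L\<close> is nonempty, \<open>s\<close> itself lies in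
      \<open>[a, t)\<close> and forms a separated pair with every key in
      \<open>[t, b)\<close>.\<close>
    then have "R \<subseteq> ?A" by (auto simp: L_def R_def crossing_pairs_def)
    then have "card R \<le> card ?A" using fin by (intro card_mono)
    then show ?thesis by linarith
  next
    case 3
    define j where "j = Max L"
    have j: "j \<in> L" "\<And>i. i \<in> L \<Longrightarrow> i \<le> j" using 3 finLR by (auto simp: j_def)
    have gt: "j < r" if "r \<in> R" for r
    proof -
      have "(2::nat) ^ j < 2 ^ r" using that j(1) unfolding L_def R_def mem_Collect_eq by linarith
      then show ?thesis by simp
    qed
    obtain r where r: "r \<in> R" using 3 by auto
    have "(2::nat) ^ Suc j \<le> 2 ^ r" using gt[OF r] by (intro power_increasing) auto
    moreover have "Suc j \<notin> L" using j(2) by fastforce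
    \<comment> \<open>The smallest key in \<open>[t, b)\<close> is \<open>s + 2 ^ Suc j\<close>,
      which exceeds the largest key \<open>s + 2 ^ j\<close> in \<open>[a, t)\<close> by exactly
      \<open>2 ^ j\<close>.\<close>
    ultimately have "j \<in> ?B"
      using j(1) r gt[OF r] by (auto simp: L_def R_def crossing_pairs_def)
    then have B: "card ?B \<ge> 1" using fin(2) by (metis One_nat_def Suc_leI card_gt_0_iff empty_iff)
    show ?thesis
    proof (cases "card R \<le> 1")
      case True
      then show ?thesis using B by linarith
    next
      case False
      have "R - {r} \<noteq> {}" using False r finLR by (metis card.insert_remove card.empty insert_absorb
            finite.emptyI One_nat_def card_Suc_Diff1 le_refl)
      then obtain r' where "r' \<in> R" "r' \<noteq> r" by auto
      then obtain r1 r2 where r12: "r1 \<in> R" "r2 \<in> R" "r1 < r2" using r by (metis linorder_neqE_nat)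
      \<comment> \<open>From \<open>t \<le> s + 2 ^ r1\<close> it follows that
        \<open>t + 2 ^ r1\<close> is at most \<open>s + 2 ^ Suc r1\<close>, hence at most
        \<open>s + 2 ^ r2\<close>, which is below \<open>b\<close>.\<close>
      have "(2::nat) ^ Suc r1 \<le> 2 ^ r2" using r12 by (intro power_increasing) auto
      then have r1: "t + 2 ^ r1 < b" using r12(1,2) by (auto simp: R_def)
      have "L - {j} \<subseteq> ?C"
      proof
        fix i assume i: "i \<in> L - {j}"
        then have ij: "i < j" using j(2) by force
        then have "(2::nat) ^ Suc i \<le> 2 ^ j" by (intro power_increasing) auto
        then have "a + 2 ^ i < t" using i j(1) by (auto simp: L_def)
        moreover have "(2::nat) ^ i \<le> 2 ^ r1" using ij gt[OF r12(1)] by (intro power_increasing) auto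
        ultimately show "i \<in> ?C"
          using i r1 \<open>s < a\<close> by (auto simp: L_def crossing_pairs_def simp del: power_increasing_iff)
      qed
      then have "card (L - {j}) \<le> card ?C" using fin by (intro card_mono)
      then have "card L \<le> card ?C + 1" using j(1) finLR by simp
      then show ?thesis using B by linarith
    qed
  qed
qed

text \<open>The sum counts pairs \<open>(s, i)\<close>, which an injective map sends into
  \<open>C\<close>.\<close>

lemma sum_card_preimage_le:
  fixes n :: nat
  assumes "finite C" "inj_on (\<lambda>(s, i). (\<phi> s i, i)) UNIV"
  shows "(\<Sum>s<n. card {i. (\<phi> s i, i) \<in> C}) \<le> card C"
proof -
  have inj: "inj_on (\<lambda>(s, i). (\<phi> s i, i)) A" for A
    using assms(2) by (rule inj_on_subset) simp
  have "{i. (\<phi> s i, i) \<in> C} \<subseteq> snd ` C" for s by force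
  then have "finite {i. (\<phi> s i, i) \<in> C}" for s by (rule finite_subset) (simp add: assms(1))
  then have "(\<Sum>s<n. card {i. (\<phi> s i, i) \<in> C}) = card (SIGMA s:{..<n}. {i. (\<phi> s i, i) \<in> C})"
    by (intro card_SigmaI[symmetric]) auto
  also have "\<dots> = card ((\<lambda>(s, i). (\<phi> s i, i)) ` (SIGMA s:{..<n}. {i. (\<phi> s i, i) \<in> C}))"
    by (intro card_image[symmetric] inj)
  also have "\<dots> \<le> card C"
    using assms(1) by (intro card_mono) auto
  finally show ?thesis .
qed

text \<open>There are three ways of charging a separated pair, and each is injective in shift and
  exponent; hence the factor 3.\<close>

lemma sum_min_card_powers_le:
  fixes a t b K n :: nat
  assumes "a \<le> t" "t \<le> b"
  shows "(\<Sum>s<n. min (card {i. i < K \<and> a \<le> s + 2 ^ i \<and> s + 2 ^ i < t})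
                      (card {i. i < K \<and> t \<le> s + 2 ^ i \<and> s + 2 ^ i < b}))
    \<le> 3 * card (crossing_pairs K a t b)"
proof -
  let ?C = "crossing_pairs K a t b"
  have "(\<Sum>s<n. card {i. (s, i) \<in> ?C}) \<le> card ?C"
    using finite_crossing_pairs by (rule sum_card_preimage_le[where \<phi> = "\<lambda>s i. s"]) (auto simp: inj_on_def)
  moreover have "(\<Sum>s<n. card {i. (s + 2 ^ i, i) \<in> ?C}) \<le> card ?C"
    using finite_crossing_pairs by (rule sum_card_preimage_le[where \<phi> = "\<lambda>s i. s + 2 ^ i"]) (auto simp: inj_on_def)
  moreover have "(\<Sum>s<n. card {i. (s + (t - a), i) \<in> ?C}) \<le> card ?C"
    using finite_crossing_pairs by (rule sum_card_preimage_le[where \<phi> = "\<lambda>s i. s + (t - a)"]) (auto simp: inj_on_def)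
  moreover have "(\<Sum>s<n. min (card {i. i < K \<and> a \<le> s + 2 ^ i \<and> s + 2 ^ i < t})
                      (card {i. i < K \<and> t \<le> s + 2 ^ i \<and> s + 2 ^ i < b}))
    \<le> (\<Sum>s<n. card {i. (s, i) \<in> ?C} + card {i. (s + 2 ^ i, i) \<in> ?C} + card {i. (s + (t - a), i) \<in> ?C})"
    by (intro sum_mono min_card_powers_le assms)
  ultimately show ?thesis by (simp add: sum.distrib)
qed

subsection \<open>The access sequence\<close>

text \<open>The quotient is the shift, which advances after \<open>M\<close> repetitions of a round
  of \<open>2 ^ k\<close> accesses; the power depends on the position within the round.\<close>

definition access_key :: "nat \<Rightarrow> nat \<Rightarrow> nat \<Rightarrow> nat" where
  "access_key k M t = t div (M * 2 ^ k) + 2 ^ bitrev k (t mod 2 ^ k)"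

definition graph_point :: "(nat \<Rightarrow> nat) \<Rightarrow> nat \<Rightarrow> point" where
  "graph_point g i = (real (g i), real (Suc i))"

lemma access_points_map: "access_points (map g [0..<m]) = graph_point g ` {..<m}"
proof -
  have "{1..m} = Suc ` {..<m}"
    by (simp add: lessThan_atLeast0 image_Suc_atLeastLessThan atLeastLessThanSuc_atLeastAtMost)
  then have "access_points (map g [0..<m])
    = (\<lambda>i. (real (map g [0..<m] ! (i - 1)), real i)) ` Suc ` {..<m}"
    by (auto simp: access_points_def simp del: nth_map_upt)
  also have "\<dots> = graph_point g ` {..<m}"
    unfolding image_image by (intro image_cong) (auto simp: graph_point_def)
  finally show ?thesis .
qed

section \<open>Upper bound on the alternation sum\<close>

text \<open>Within the window of shift \<open>s\<close>, a time is determined by its repetition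
  number and by the exponent of its key.\<close>

lemma card_window_keys_le:
  assumes "M > 0"
  shows "card {t. Q (access_key k M t) \<and> t div (M * 2 ^ k) = s}
    \<le> M * card {i. i < 2 ^ k \<and> Q (s + 2 ^ i)}"
proof -
  let ?A = "{t. Q (access_key k M t) \<and> t div (M * 2 ^ k) = s}"
  let ?f = "\<lambda>t. (t div 2 ^ k mod M, bitrev k (t mod 2 ^ k))"
  have "inj_on ?f ?A"
  proof (rule inj_onI)
    fix t u assume *: "t \<in> ?A" "u \<in> ?A" "?f t = ?f u"
    have eq: "t div 2 ^ k mod M = u div 2 ^ k mod M" "bitrev k (t mod 2 ^ k) = bitrev k (u mod 2 ^ k)"
      using *(3) by (simp_all only: prod.inject)
    have "t mod 2 ^ k = u mod 2 ^ k"
      by (rule inj_onD[OF inj_on_bitrev eq(2)]) simp_all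
    moreover have "t div 2 ^ k div M = u div 2 ^ k div M"
      using *(1,2) by (simp add: div_mult2_eq mult.commute[of M])
    then have "t div 2 ^ k = u div 2 ^ k" using eq(1) by (metis div_mult_mod_eq)
    ultimately show "t = u" by (metis div_mult_mod_eq)
  qed
  then have "card ?A = card (?f ` ?A)" by (simp add: card_image)
  also have "\<dots> \<le> card ({..<M} \<times> {i. i < 2 ^ k \<and> Q (s + 2 ^ i)})"
    using assms bitrev_less by (intro card_mono) (auto simp: access_key_def)
  finally show ?thesis by (simp add: card_cartesian_product)
qed

text \<open>Each inner node costs at most \<open>S\<close>, one unit per shift, plus
  \<open>6 * M\<close> per edge it separates. A tree has one inner node fewer than leaves, hence the
  \<open>S\<close> on the left; the general interval \<open>[a, b)\<close> lets the induction
  descend to subtrees.\<close>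

lemma Alt_le:
  fixes k M S m a b :: nat
  defines "g \<equiv> access_key k M"
  assumes "M > 0" "m = S * (M * 2 ^ k)"
    and "sorted_wrt (<) (leaf_labels T)"
    and "set (leaf_labels T) = real ` (g ` {..<m} \<inter> {a..<b})"
  shows "Alt T (graph_point g ` {i. i < m \<and> g i \<in> {a..<b}}) + S
    \<le> length (leaf_labels T) * S + 6 * M * card (inner_pairs (2 ^ k) a b)"
  using assms(4-)
proof (induction T arbitrary: a b)
  case (Leaf x)
  then show ?case by simp
next
  case (Node l r)
  let ?Q = "g ` {..<m}" and ?P = "\<lambda>a b. graph_point g ` {i. i < m \<and> g i \<in> {a..<b}}"
  let ?W = "M * 2 ^ k"
  have lr: "\<And>x y. x \<in> set (leaf_labels l) \<Longrightarrow> y \<in> set (leaf_labels r) \<Longrightarrow> x < y"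
    and sl: "sorted_wrt (<) (leaf_labels l)" and sr: "sorted_wrt (<) (leaf_labels r)"
    using Node.prems(1) by (auto simp: sorted_wrt_append)
  have un: "set (leaf_labels l) \<union> set (leaf_labels r) = real ` (?Q \<inter> {a..<b})"
    using Node.prems(2) by simp
  have "set (leaf_labels r) \<noteq> {}" by (induction r) auto
  \<comment> \<open>The least label of the right subtree is the threshold that splits
    \<open>[a, b)\<close>.\<close>
  then obtain t' where t': "t' \<in> set (leaf_labels r)" "\<And>y. y \<in> set (leaf_labels r) \<Longrightarrow> t' \<le> y"
    using Min_in[of "set (leaf_labels r)"] Min_le[of "set (leaf_labels r)"] by blast
  then obtain t where t: "t' = real t" "t \<in> ?Q" "a \<le> t" "t < b" using un by fastforce
  have l: "set (leaf_labels l) = real ` (?Q \<inter> {a..<t})"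
  proof (intro equalityI subsetI)
    fix x assume x: "x \<in> set (leaf_labels l)"
    then obtain x' where "x = real x'" "x' \<in> ?Q \<inter> {a..<b}" using un by blast
    moreover have "x < real t" using lr[OF x t'(1)] t(1) by simp
    ultimately show "x \<in> real ` (?Q \<inter> {a..<t})" by auto
  next
    fix x assume "x \<in> real ` (?Q \<inter> {a..<t})"
    then obtain x' where x': "x = real x'" "x' \<in> ?Q \<inter> {a..<t}" by blast
    then have "x \<in> set (leaf_labels l) \<union> set (leaf_labels r)" using un t(4) by auto
    moreover have "x \<notin> set (leaf_labels r)" using t'(2)[of x] x' t(1) by auto
    ultimately show "x \<in> set (leaf_labels l)" by simp
  qed
  have r: "set (leaf_labels r) = real ` (?Q \<inter> {t..<b})"
  proof (intro equalityI subsetI)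
    fix x assume x: "x \<in> set (leaf_labels r)"
    then obtain x' where "x = real x'" "x' \<in> ?Q \<inter> {a..<b}" using un by blast
    moreover have "real t \<le> x" using t'(2)[OF x] t(1) by simp
    ultimately show "x \<in> real ` (?Q \<inter> {t..<b})" by auto
  next
    fix x assume "x \<in> real ` (?Q \<inter> {t..<b})"
    then obtain x' where x': "x = real x'" "x' \<in> ?Q \<inter> {t..<b}" by blast
    then have "x \<in> set (leaf_labels l) \<union> set (leaf_labels r)" using un t(3) by auto
    moreover have "x \<notin> set (leaf_labels l)" using lr[OF _ t'(1), of x] x' t(1) by auto
    ultimately show "x \<in> set (leaf_labels r)" by simp
  qed
  have PL: "{p \<in> ?P a b. fst p \<in> set (leaf_labels l)} = ?P a t"
    unfolding l using t(4) by (auto simp: graph_point_def)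
  have PR: "{p \<in> ?P a b. fst p \<in> set (leaf_labels r)} = ?P t b"
    unfolding r using t(3) by (auto simp: graph_point_def)
  have snd_P: "snd ` ?P c d = (\<lambda>i. real (Suc i)) ` {i. i < m \<and> g i \<in> {c..<d}}" for c d
    by (simp add: image_image graph_point_def)
  have win: "card {i \<in> {i. i < m \<and> g i \<in> {c..<d}}. i div ?W = s}
    \<le> M * card {i. i < 2 ^ k \<and> c \<le> s + 2 ^ i \<and> s + 2 ^ i < d}" for c d s
  proof -
    have "finite {t. g t \<in> {c..<d} \<and> t div ?W = s}"
    proof (rule finite_subset)
      show "{t. g t \<in> {c..<d} \<and> t div ?W = s} \<subseteq> {..<Suc s * ?W}"
        using assms(2) by (auto simp: div_less_iff_less_mult[symmetric] simp del: mult_Suc)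
    qed simp
    then have "card {i \<in> {i. i < m \<and> g i \<in> {c..<d}}. i div ?W = s}
      \<le> card {t. g t \<in> {c..<d} \<and> t div ?W = s}"
      by (intro card_mono) auto
    also have "\<dots> \<le> M * card {i. i < 2 ^ k \<and> s + 2 ^ i \<in> {c..<d}}"
      unfolding g_def using card_window_keys_le[OF assms(2), of "\<lambda>x. x \<in> {c..<d}"] .
    finally show ?thesis by simp
  qed
  \<comment> \<open>The windows of length \<open>?W\<close> are exactly the periods of constant
    shift.\<close>
  have "mix_value (snd ` ?P a t) (snd ` ?P t b)
    \<le> (\<Sum>s<S. 2 * min (card {i \<in> {i. i < m \<and> g i \<in> {a..<t}}. i div ?W = s})
                     (card {i \<in> {i. i < m \<and> g i \<in> {t..<b}}. i div ?W = s}) + 1)"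
    unfolding snd_P using assms(3) by (intro mix_value_windows) auto
  also have "\<dots> \<le> (\<Sum>s<S. 2 * (M * min (card {i. i < 2 ^ k \<and> a \<le> s + 2 ^ i \<and> s + 2 ^ i < t})
                      (card {i. i < 2 ^ k \<and> t \<le> s + 2 ^ i \<and> s + 2 ^ i < b})) + 1)"
    unfolding min_mult_distrib_left nat_mult_min_right
    by (intro sum_mono add_mono mult_left_mono min.mono win order_refl) auto
  also have "\<dots> = 2 * M * (\<Sum>s<S. min (card {i. i < 2 ^ k \<and> a \<le> s + 2 ^ i \<and> s + 2 ^ i < t})
                      (card {i. i < 2 ^ k \<and> t \<le> s + 2 ^ i \<and> s + 2 ^ i < b})) + S"
    by (subst sum.distrib) (simp add: sum_distrib_left mult.assoc)
  also have "\<dots> \<le> 2 * M * (3 * card (crossing_pairs (2 ^ k) a t b)) + S"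
    using t by (intro add_mono mult_left_mono sum_min_card_powers_le order_refl) auto
  \<comment> \<open>The factor 6 is the 2 of the block estimate times the 3 of the charging
    argument.\<close>
  finally have mix: "mix_value (snd ` ?P a t) (snd ` ?P t b)
    \<le> 6 * M * card (crossing_pairs (2 ^ k) a t b) + S" by simp
  have "Alt (Node l r) (?P a b) = mix_value (snd ` ?P a t) (snd ` ?P t b) + Alt l (?P a t) + Alt r (?P t b)"
    by (simp only: Alt.simps Let_def PL PR)
  moreover have "Alt l (?P a t) + S \<le> length (leaf_labels l) * S + 6 * M * card (inner_pairs (2 ^ k) a t)"
    by (intro Node.IH sl l)
  moreover have "Alt r (?P t b) + S \<le> length (leaf_labels r) * S + 6 * M * card (inner_pairs (2 ^ k) t b)"
    by (intro Node.IH sr r)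
  moreover have "6 * M * (card (inner_pairs (2 ^ k) a t) + card (inner_pairs (2 ^ k) t b)
      + card (crossing_pairs (2 ^ k) a t b)) \<le> 6 * M * card (inner_pairs (2 ^ k) a b)"
    using t by (intro mult_left_mono card_inner_pairs_split) auto
  ultimately show ?case using mix by (simp add: algebra_simps)
qed

section \<open>Lower bound on the funnel sum\<close>

lemma sum_mod_periodic:
  fixes h :: "nat \<Rightarrow> nat"
  shows "(\<Sum>i<n * W. h (i mod W)) = n * (\<Sum>r<W. h r)"
proof -
  have "(\<Sum>i = c * W..<c * W + W. h (i mod W)) = (\<Sum>r<W. h r)" for c
  proof (rule sum.reindex_bij_witness[of _ "\<lambda>r. c * W + r" "\<lambda>i. i - c * W"])
    fix i assume i: "i \<in> {c * W..<c * W + W}"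
    have "(c * W + (i - c * W)) mod W = i - c * W" using i by (subst mod_mult_self3) (auto intro!: mod_less)
    moreover have "c * W + (i - c * W) = i" using i by simp
    ultimately show "h (i - c * W) = h (i mod W)" by (simp only:)
  qed auto
  then show ?thesis by (simp flip: sum.nat_group)
qed

text \<open>Going back by at most the position within the round stays in the same round, so the
  shift does not change.\<close>

lemma access_key_sub:
  assumes "u \<le> i mod 2 ^ k"
  shows "access_key k M (i - u) = i div (M * 2 ^ k) + 2 ^ bitrev k (i mod 2 ^ k - u)"
proof -
  have e: "i - u = 2 ^ k * (i div 2 ^ k) + (i mod 2 ^ k - u)"
    using assms by (metis Nat.add_diff_assoc mult_div_mod_eq)
  have "i mod 2 ^ k - u < 2 ^ k" by (simp add: less_imp_diff_less)
  then have "(i - u) div 2 ^ k = i div 2 ^ k" "(i - u) mod 2 ^ k = i mod 2 ^ k - u"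
    unfolding e by simp_all
  then show ?thesis by (simp add: access_key_def div_mult2_eq mult.commute[of M])
qed

text \<open>As bit \<open>k\<close> of the position is set, the steps back by
  \<open>2 ^ 0, ..., 2 ^ k\<close> all stay in the current round, where comparing keys means
  comparing bit reversals. These \<open>k + 1\<close> funnel points already give the bound.\<close>

lemma funnel_value_ge:
  fixes k M m i :: nat
  defines "g \<equiv> access_key (Suc k) M"
  assumes "i < m" "2 ^ k \<le> i mod 2 ^ Suc k"
  shows "bit_changes k (i mod 2 ^ Suc k) + 1 \<le> funnel_value (graph_point g ` {..<m}) (graph_point g i)"
proof -
  define r where "r = i mod 2 ^ Suc k"
  let ?P = "graph_point g ` {..<m}" and ?p = "graph_point g i"
  let ?L = "snd ` left_funnel ?P ?p" and ?R = "snd ` right_funnel ?P ?p"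
  define y where "y j = real (Suc (i - 2 ^ j))" for j
  have fin: "finite ?L" "finite ?R" by (auto simp: left_funnel_def right_funnel_def)
  have key: "g (i - u) = i div (M * 2 ^ Suc k) + 2 ^ bitrev (Suc k) (r - u)" if "u \<le> r" for u
    using access_key_sub[of u i "Suc k" M] that by (simp only: g_def r_def)
  have ri: "r \<le> i" by (simp add: r_def)
  have pow: "2 ^ j \<le> r" if "j \<le> k" for j
    using assms(3) power_increasing[OF that, of "2::nat"] unfolding r_def by linarith
  have empty: "?P \<inter> rect ?p (graph_point g (i - 2 ^ j)) = {?p, graph_point g (i - 2 ^ j)}"
    if j: "j \<le> k" for j
  proof (intro equalityI subsetI)
    fix z assume z: "z \<in> ?P \<inter> rect ?p (graph_point g (i - 2 ^ j))"
    then obtain i' where i': "z = graph_point g i'" by blast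
    have *: "i - 2 ^ j \<le> i'" "i' \<le> i" "min (g i) (g (i - 2 ^ j)) \<le> g i'"
      "g i' \<le> max (g i) (g (i - 2 ^ j))"
      using z unfolding i' rect_def graph_point_def by auto
    show "z \<in> {?p, graph_point g (i - 2 ^ j)}"
    proof (rule ccontr)
      assume "z \<notin> {?p, graph_point g (i - 2 ^ j)}"
      then have ne: "i' \<noteq> i" "i' \<noteq> i - 2 ^ j" using i' by auto
      \<comment> \<open>A further point of the rectangle would be accessed strictly between the two
        corners, in the same round, where bit reversal keeps its key out of the range between
        theirs.\<close>
      define u where "u = i - i'"
      have u: "i' = i - u" "0 < u" "u < 2 ^ j" using * ne pow[OF j] ri by (auto simp: u_def)
      have "bitrev (Suc k) (r - u) < min (bitrev (Suc k) r) (bitrev (Suc k) (r - 2 ^ j)) \<or>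
         max (bitrev (Suc k) r) (bitrev (Suc k) (r - 2 ^ j)) < bitrev (Suc k) (r - u)"
        using u pow[OF j] j by (intro bitrev_not_between) auto
      then show False
        using *(3,4) key[of 0] key[of u] key[of "2 ^ j"] u pow[OF j]
        by (auto simp: min_def max_def simp del: bitrev.simps split: if_splits)
    qed
  next
    fix z assume "z \<in> {?p, graph_point g (i - 2 ^ j)}"
    then show "z \<in> ?P \<inter> rect ?p (graph_point g (i - 2 ^ j))"
      using assms(2) by (auto simp: rect_def graph_point_def)
  qed
  have lt: "i - 2 ^ j < i" if "j \<le> k" for j
    using pow[OF that] ri zero_less_power[of "2::nat" j] by linarith
  have left: "graph_point g (i - 2 ^ j) \<in> left_funnel ?P ?p"
    if "j \<le> k" "odd (r div 2 ^ j)" for j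
  proof -
    have "bitrev (Suc k) (r - 2 ^ j) < bitrev (Suc k) r"
      using bitrev_sub_power[of j "Suc k" r] pow that by (auto simp del: bitrev.simps)
    then have "g (i - 2 ^ j) < g i"
      using key[of 0] key[of "2 ^ j"] pow that by (simp del: bitrev.simps)
    then show ?thesis
      using empty[OF that(1)] lt[OF that(1)] assms(2)
      by (auto simp: left_funnel_def graph_point_def)
  qed
  have right: "graph_point g (i - 2 ^ j) \<in> right_funnel ?P ?p"
    if "j \<le> k" "even (r div 2 ^ j)" for j
  proof -
    have "bitrev (Suc k) r < bitrev (Suc k) (r - 2 ^ j)"
      using bitrev_sub_power[of j "Suc k" r] pow that by (auto simp del: bitrev.simps)
    then have "g i < g (i - 2 ^ j)"
      using key[of 0] key[of "2 ^ j"] pow that by (simp del: bitrev.simps)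
    then show ?thesis
      using empty[OF that(1)] lt[OF that(1)] assms(2)
      by (auto simp: right_funnel_def graph_point_def)
  qed
  have snd_q: "snd (graph_point g (i - 2 ^ j)) = y j" for j by (simp add: graph_point_def y_def)
  have disj: "?L \<inter> ?R = {}"
    by (auto simp: left_funnel_def right_funnel_def graph_point_def)
  have yL: "y j \<in> ?L" if "j \<le> k" "odd (r div 2 ^ j)" for j
    using imageI[OF left[OF that], of snd] unfolding snd_q .
  have yR: "y j \<in> ?R" if "j \<le> k" "even (r div 2 ^ j)" for j
    using imageI[OF right[OF that], of snd] unfolding snd_q .
  have iff: "y j \<in> ?L \<longleftrightarrow> odd (r div 2 ^ j)" if "j \<le> k" for j
    using yL[OF that] yR[OF that] disj by blast
  have "card {j. j < k \<and> (y j \<in> ?L) \<noteq> (y (Suc j) \<in> ?L)} + 1 \<le> mix_value ?L ?R"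
  proof (rule mix_value_ge_alternations[OF fin])
    fix a b :: nat assume ab: "a < b" "b \<le> k"
    then have "(2::nat) ^ a < 2 ^ b" by simp
    then show "y b < y a" using pow[OF ab(2)] ri unfolding y_def of_nat_less_iff by linarith
  next
    fix j assume "j \<le> k"
    then show "y j \<in> ?L \<union> ?R" using yL yR by blast
  qed
  moreover have "{j. j < k \<and> (y j \<in> ?L) \<noteq> (y (Suc j) \<in> ?L)}
    = {j. j < k \<and> odd (r div 2 ^ j) \<noteq> odd (r div 2 ^ Suc j)}"
    by (intro Collect_cong conj_cong refl) (simp only: iff Suc_le_eq less_imp_le)
  ultimately show ?thesis
    unfolding funnel_value_def bit_changes_def r_def by simp
qed

text \<open>Only the second half of each round is counted. There the funnel value is at least
  \<open>k / 2 + 1\<close> on average, which gives \<open>(k + 2) / 4\<close> per access.\<close>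

lemma Funnel_ge:
  fixes k M m S :: nat
  defines "g \<equiv> access_key (Suc k) M"
  assumes "m = S * (M * 2 ^ Suc k)"
  shows "m * (k + 2) \<le> 4 * Funnel (graph_point g ` {..<m})"
proof -
  let ?P = "graph_point g ` {..<m}"
  let ?h = "\<lambda>r. if 2 ^ k \<le> r then bit_changes k r + 1 else 0"
  have "(\<Sum>r<2 ^ Suc k. ?h r) = (\<Sum>r = 2 ^ k..<2 ^ Suc k. bit_changes k r + 1)"
    by (rule sum.mono_neutral_cong_right) auto
  also have "\<dots> = (\<Sum>r = 2 ^ k..<2 ^ Suc k. bit_changes k r) + 2 ^ k"
    by (subst sum.distrib) simp
  finally have h: "4 * (\<Sum>r<2 ^ Suc k. ?h r) = 2 ^ Suc k * (k + 2)"
    using sum_bit_changes[of k] by (simp add: algebra_simps)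
  have "4 * (\<Sum>i<m. ?h (i mod 2 ^ Suc k)) = 4 * (\<Sum>i<S * M * 2 ^ Suc k. ?h (i mod 2 ^ Suc k))"
    by (simp only: assms(2) mult.assoc)
  also have "\<dots> = S * M * (4 * (\<Sum>r<2 ^ Suc k. ?h r))"
    by (subst sum_mod_periodic) (simp only: mult_ac)
  also have "\<dots> = m * (k + 2)" unfolding h assms(2) by (simp only: mult_ac)
  finally have "m * (k + 2) = 4 * (\<Sum>i<m. ?h (i mod 2 ^ Suc k))" by simp
  also have "\<dots> \<le> 4 * (\<Sum>i<m. funnel_value ?P (graph_point g i))"
    using funnel_value_ge[of _ m k M] by (intro mult_left_mono sum_mono) (auto simp: g_def)
  also have "(\<Sum>i<m. funnel_value ?P (graph_point g i)) = Funnel ?P"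
    unfolding Funnel_def by (subst sum.reindex) (auto simp: inj_on_def graph_point_def)
  finally show ?thesis .
qed

section \<open>Choice of parameters and comparison of the two bounds\<close>

theorem theorem2:
  "\<exists>c::real. c > 0 \<and>
     (\<forall>N::nat. \<exists>n\<ge>N. \<exists>X::nat list. X \<noteq> [] \<and> set X \<subseteq> {1..n} \<and>
        (\<forall>T. is_reference_tree T (access_points X) \<longrightarrow>
           real (Funnel (access_points X)) \<ge>
             c * log 2 (log 2 (real n)) * (real (Alt T (access_points X)) + real (length X))))"
\<comment> \<open>Here 60 is 15 times 4: \<open>Alt\<close> plus the length is at most
  \<open>15 * m\<close>, and \<open>m * (N + 2)\<close> is at most four times the funnel
  sum.\<close>
proof (rule exI[of _ "1 / 60"], intro conjI allI)
  show "(1 / 60 :: real) > 0" by simp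
  fix N :: nat
  \<comment> \<open>With \<open>n = 2 ^ K\<close>, the iterated logarithm of \<open>n\<close> is
    \<open>Suc N\<close>.\<close>
  define K :: nat where "K = 2 ^ Suc N"
  \<comment> \<open>\<open>S\<close> is the largest power added to a shift, so shifts below
    \<open>S\<close> keep all keys below \<open>2 * S\<close>. Repeating each shift \<open>S\<close>
    times makes \<open>m\<close> large enough to absorb the cost \<open>S\<close> of each of fewer
    than \<open>2 * S\<close> nodes.\<close>
  define S :: nat where "S = 2 ^ (K - 1)"
  define m where "m = S * (S * K)"
  define g where "g = access_key (Suc N) S"
  define X where "X = map g [0..<m]"
  have pos: "K > 0" "S > 0" by (simp_all add: K_def S_def)
  have S2: "2 * S = 2 ^ K" using pos by (simp add: S_def power_eq_if)
  have P: "access_points X = graph_point g ` {..<m}" by (simp add: X_def access_points_map)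
  have bound: "1 \<le> g i" "g i < 2 * S" if "i < m" for i
  proof -
    have "i div (S * K) < S" using that pos by (simp add: m_def div_less_iff_less_mult)
    moreover have "bitrev (Suc N) (i mod K) \<le> K - 1"
      using bitrev_less[of "Suc N" "i mod K"] unfolding K_def by linarith
    then have "(2::nat) ^ bitrev (Suc N) (i mod K) \<le> S"
      unfolding S_def by (intro power_increasing) auto
    ultimately show "g i < 2 * S" unfolding g_def access_key_def K_def by linarith
    have "1 \<le> (2::nat) ^ bitrev (Suc N) (i mod K)" by simp
    then show "1 \<le> g i" unfolding g_def access_key_def K_def by linarith
  qed
  have bound_ratio: "real (Funnel (access_points X)) \<ge>
      1 / 60 * log 2 (log 2 (real (2 ^ K))) * (real (Alt T (access_points X)) + real (length X))"
    if T: "is_reference_tree T (access_points X)" for T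
  proof -
    have keys: "g ` {..<m} \<inter> {0..<2 * S} = g ` {..<m}" "{i. i < m \<and> g i \<in> {0..<2 * S}} = {..<m}"
      using bound by auto
    have labels: "set (leaf_labels T) = real ` g ` {..<m}" and sorted: "sorted_wrt (<) (leaf_labels T)"
      using T by (auto simp: is_reference_tree_def P graph_point_def image_image)
    have "length (leaf_labels T) = card (g ` {..<m})"
      using sorted distinct_card[of "leaf_labels T"]
      by (simp add: strict_sorted_iff labels card_image inj_on_def)
    also have "\<dots> \<le> card {0..<2 * S}" using bound by (intro card_mono) auto
    finally have len: "length (leaf_labels T) * S \<le> 2 * S * S" by simp
    have "Alt T (graph_point g ` {..<m}) + S
      \<le> length (leaf_labels T) * S + 6 * S * card (inner_pairs K 0 (2 * S))"
      using Alt_le[of S m S "Suc N" T 0 "2 * S"] pos keys labels sorted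
      unfolding K_def[symmetric] g_def[symmetric] by (simp add: m_def)
    also have "\<dots> \<le> 2 * S * S + 6 * S * (2 * S * K)"
      using card_inner_pairs_le[of K 0 "2 * S"] len by (intro add_mono mult_left_mono) auto
    \<comment> \<open>The nodes contribute at most \<open>2 * m\<close> and the edges
      \<open>12 * m\<close>; the length adds one more \<open>m\<close> below.\<close>
    also have "\<dots> \<le> 14 * m"
      using pos by (simp add: m_def algebra_simps)
    finally have "real (Alt T (access_points X)) + real (length X) \<le> 15 * real m"
      unfolding P by (simp add: X_def)
    then have "real (Suc N) * (real (Alt T (access_points X)) + real (length X))
      \<le> real (N + 2) * (15 * real m)"
      by (intro mult_mono) auto
    also have "\<dots> = 15 * real (m * (N + 2))" by (simp add: algebra_simps)
    also have "\<dots> \<le> 15 * real (4 * Funnel (access_points X))"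
      unfolding P g_def using Funnel_ge[of m S S N] m_def K_def
      by (intro mult_left_mono of_nat_mono) auto
    finally have "1 / 60 * real (Suc N) * (real (Alt T (access_points X)) + real (length X))
      \<le> real (Funnel (access_points X))" by simp
    moreover have "log 2 (log 2 (real (2 ^ K))) = real (Suc N)"
      by (simp add: log_nat_power K_def del: power_Suc)
    ultimately show ?thesis by simp
  qed
  show "\<exists>n\<ge>N. \<exists>X::nat list. X \<noteq> [] \<and> set X \<subseteq> {1..n} \<and>
        (\<forall>T. is_reference_tree T (access_points X) \<longrightarrow>
           real (Funnel (access_points X)) \<ge>
             1 / 60 * log 2 (log 2 (real n)) * (real (Alt T (access_points X)) + real (length X)))"
  proof (intro exI conjI allI impI)
    have "N < 2 ^ N" by simp
    also have "\<dots> \<le> K" by (simp add: K_def)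
    also have "\<dots> < 2 ^ K" by simp
    finally show "N \<le> 2 ^ K" by simp
    show "X \<noteq> []" using pos by (simp add: X_def m_def)
    show "set X \<subseteq> {1..2 ^ K}" using bound unfolding S2 X_def by (fastforce intro: less_imp_le)
  qed (rule bound_ratio)
qed

end
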